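(* Every countable (not necessarily unital) von Neumann regular ring $R$ has a Banaschewski function; that is, there exists a map $f$ from $R$ to the set of idempotent elements of $R$ such that (i) $xR=f(x)R$ for each $x\in R$, and (ii) $xR\subseteq yR$ implies $f(x)\trianglelefteq f(y)$, for all $x,y\in R$.
   Context: "Countable" means at most countable. Rings are associative but not necessarily unital. A ring $R$ is von Neumann regular if for each $x\in R$ there exists $y\in R$ such that $xyx=x$. For idempotents $a,b$ in a ring, $a\trianglelefteq b$ means $a=ab=ba$. A Banaschewski function on a ring $R$ is a map $f$ from $R$ to the set of idempotents of $R$ satisfying conditions (i) and (ii) of the claim. *)

theory Defs
  imports "HOL-Library.Countable_Set"
begin

(* The type class ring is associative and does not require a unit. *)

definition von_neumann_regular :: "'a::ring itself \<Rightarrow> bool" where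
  "von_neumann_regular _ \<longleftrightarrow> (\<forall>x::'a. \<exists>y. x * y * x = x)"

definition idempotents :: "'a::ring set" where
  "idempotents = {a. a * a = a}"

(* The order on idempotents, stated for arbitrary elements; it is only applied to idempotents. *)
definition idem_le :: "'a::ring \<Rightarrow> 'a \<Rightarrow> bool"  (infix "\<unlhd>" 50) where
  "a \<unlhd> b \<longleftrightarrow> a = a * b \<and> a = b * a"

(* The set xR of right multiples of x. Without a unit, x need not belong to it in general. *)
definition right_multiples :: "'a::ring \<Rightarrow> 'a set" where
  "right_multiples x = range (\<lambda>r. x * r)"

definition banaschewski_function :: "('a::ring \<Rightarrow> 'a) \<Rightarrow> bool" where
  "banaschewski_function f \<longleftrightarrow>
     range f \<subseteq> idempotents \<and>
     (\<forall>x. right_multiples x = right_multiples (f x)) \<and>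
     (\<forall>x y. right_multiples x \<subseteq> right_multiples y \<longrightarrow> f x \<unlhd> f y)"

end

theory Submission
  imports Defs
begin

text \<open>
  The construction imitates the greedy choice of complements in a vector space with a well-ordered
  basis: the basis vectors \<open>b\<close> that do not lie in \<open>X\<close> plus the span of their predecessors
  span a complement of \<open>X\<close>. Enlarging \<open>X\<close> can only remove vectors from this complement, so the
  projections \<open>p\<close> and \<open>q\<close> onto \<open>X \<subseteq> Y\<close> along these complements satisfy \<open>p = p q = q p\<close>.

  In a regular ring a finite list of elements takes the place of the basis. An element \<open>a\<close> of such
  a list may be undecided for a principal right ideal \<open>X\<close>: it need not lie in the sum of \<open>X\<close> and
  the span \<open>M\<close> of its predecessors, nor need \<open>a R\<close> meet that sum trivially. Regularity permits to
  cut it into two pieces, \<open>a = (a - h) + h\<close>, the first in \<open>X + M\<close> and the second independent of it;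
  listing the first piece before the second makes both of them decided. Doing so for every entry
  gives a list that decides \<open>X\<close> (lemma \<open>exists_adapted_refinement\<close>). A cut keeps all ideals
  decided that were decided before (lemma \<open>refines_cut\<close>), and so does appending a new element to
  let the list span a larger part of the ring (lemma \<open>next_stage\<close>). Without a unit there is no
  finite list that spans \<open>R\<close>, but the list for \<open>X\<close> only has to span a principal right ideal
  \<open>e R \<supseteq> X\<close>; the projection onto \<open>X\<close> is extended by \<open>0\<close> on everything appended later.

  Since \<open>R\<close> is countable, a single sequence of lists, each refining and prolonging the one before,
  decides all principal right ideals, each at some finite stage. Any two of them are
  decided at a common stage, where the comparison of greedy complements
  (lemma \<open>adapted_mono\<close>) applies.
\<close>

section \<open>Spans of lists and adapted idempotents\<close>

text \<open>Lists are written with the last vector of the ordered system at the head, so that the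
  predecessors of an entry form the tail behind it.\<close>

primrec rspan :: "'a::ring list \<Rightarrow> 'a set" where
  "rspan [] = {0}"
| "rspan (a # M) = {a * r + s | r s. s \<in> rspan M}"

text \<open>If the right ideals generated by the entries are independent, an idempotent \<open>p\<close> is adapted
  precisely when the list decides \<open>p R\<close> and \<open>p\<close> vanishes on the greedy complement, that is, on
  the entries outside the sum of \<open>p R\<close> and the span of their predecessors.\<close>

primrec adapted :: "'a::ring \<Rightarrow> 'a list \<Rightarrow> bool" where
  "adapted p [] \<longleftrightarrow> True"
| "adapted p (a # M) \<longleftrightarrow>
     adapted p M \<and> (p * a = 0 \<or> (\<exists>r. \<exists>s\<in>rspan M. a = p * r + s))"

definition refines :: "'a::ring list \<Rightarrow> 'a list \<Rightarrow> bool" where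
  "refines L' L \<longleftrightarrow> rspan L' = rspan L \<and> (\<forall>q. adapted q L \<longrightarrow> adapted q L')"

lemma zero_in_rspan: "0 \<in> rspan L"
  by (induction L) (auto intro!: exI[of _ 0])

lemma rspan_mult: "s \<in> rspan L \<Longrightarrow> s * r \<in> rspan L"
proof (induction L arbitrary: s)
  case (Cons a M)
  then obtain t s' where "s = a * t + s'" "s' \<in> rspan M" by auto
  then have "s * r = a * (t * r) + s' * r" "s' * r \<in> rspan M"
    using Cons.IH by (auto simp: algebra_simps)
  then show ?case by auto
qed simp

lemma rspan_diff: "s \<in> rspan L \<Longrightarrow> t \<in> rspan L \<Longrightarrow> s - t \<in> rspan L"
proof (induction L arbitrary: s t)
  case (Cons a M)
  then obtain r1 s1 r2 s2 where "s1 \<in> rspan M" "s = a * r1 + s1" "s2 \<in> rspan M" "t = a * r2 + s2"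
    by auto
  then have "s - t = a * (r1 - r2) + (s1 - s2)" "s1 - s2 \<in> rspan M"
    using Cons.IH by (auto simp: algebra_simps)
  then show ?case by auto
qed simp

lemma rspan_mono_Cons: "s \<in> rspan M \<Longrightarrow> s \<in> rspan (a # M)"
  unfolding rspan.simps by (intro CollectI exI[of _ 0] exI[of _ s]) simp

lemma regular_reflexive_inverse:
  fixes x :: "'a::ring"
  assumes "von_neumann_regular TYPE('a)"
  obtains y where "x * y * x = x" "y * x * y = y"
proof -
  obtain z where z: "x * z * x = x"
    using assms unfolding von_neumann_regular_def by blast
  then have z': "x * (z * (x * c)) = x * c" for c by (metis mult.assoc)
  show thesis
    by (rule that[of "z * x * z"]) (use z z' in \<open>simp_all add: mult.assoc\<close>)
qed

lemma mem_right_multiples_idem: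
  fixes e :: "'a::ring"
  assumes "e * e = e"
  shows "s \<in> right_multiples e \<longleftrightarrow> e * s = s"
  unfolding right_multiples_def using assms by (auto simp: mult.assoc[symmetric]) (metis rangeI)

lemma right_multiples_idem_subset:
  fixes p q :: "'a::ring"
  assumes "p * p = p" "q * q = q"
  shows "right_multiples p \<subseteq> right_multiples q \<longleftrightarrow> q * p = p"
proof
  assume "right_multiples p \<subseteq> right_multiples q"
  then have "p \<in> right_multiples q"
    using assms(1) mem_right_multiples_idem by blast
  then show "q * p = p" using assms(2) mem_right_multiples_idem by blast
next
  assume *: "q * p = p"
  show "right_multiples p \<subseteq> right_multiples q"
  proof
    fix s assume "s \<in> right_multiples p"
    then have "p * s = s" using assms(1) mem_right_multiples_idem by blast
    with * have "q * s = s" by (metis mult.assoc)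
    then show "s \<in> right_multiples q" using assms(2) mem_right_multiples_idem by blast
  qed
qed

lemma adapted_cong:
  fixes p :: "'a::ring"
  assumes "von_neumann_regular TYPE('a)"
    and "adapted p L" "\<And>s. s \<in> rspan L \<Longrightarrow> p' * s = p * s" "p' * p = p"
  shows "adapted p' L"
  using assms(2,3)
proof (induction L)
  case (Cons b N)
  obtain z where "b * z * b = b" using regular_reflexive_inverse[OF assms(1)] .
  then have "b = b * (z * b) + 0" by (simp add: mult.assoc)
  then have "b \<in> rspan (b # N)" using zero_in_rspan[of N] unfolding rspan.simps by blast
  then have "p' * b = p * b" using Cons.prems(2) by blast
  moreover have "p * r = p' * (p * r)" for r using assms(4) by (metis mult.assoc)
  moreover have "adapted p' N" using Cons rspan_mono_Cons[of _ N b] by auto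
  ultimately show ?case using Cons.prems(1) by (metis adapted.simps(2))
qed simp

section \<open>Comparison of adapted idempotents\<close>

text \<open>This is the antitonicity of greedy complements, with \<open>p R \<subseteq> q R\<close>: if an entry \<open>a\<close> is
  congruent modulo \<open>p R\<close> to an element of the span of its predecessors, then also modulo the
  larger ideal \<open>q R\<close>. Hence \<open>p\<close> and \<open>q\<close> both vanish on \<open>a\<close>, or \<open>a - q a = t - q t\<close> for some \<open>t\<close>
  in that span, and the claim for \<open>a\<close> follows from the one for \<open>t\<close>.\<close>

lemma adapted_eq_on_rspan:
  fixes p q :: "'a::ring"
  assumes "q * q = q" "q * p = p" "adapted p L" "adapted q L" "s \<in> rspan L"
  shows "p * (q * s) = p * s"
  using assms(3-5)
proof (induction L arbitrary: s)
  case (Cons a M)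
  have IH: "p * (q * t) = p * t" if "t \<in> rspan M" for t
    using Cons that by auto
  have qq: "q * (q * c) = q * c" and qp: "q * (p * c) = p * c" for c
    using assms(1,2) by (metis mult.assoc)+
  have a: "p * (q * a) = p * a"
  proof (cases "q * a = 0")
    case True
    show ?thesis
    proof (cases "p * a = 0")
      case False
      then obtain r t where t: "t \<in> rspan M" "a = p * r + t"
        using Cons.prems(1) by auto
      have "q * a = p * r + q * t" using t(2) qp by (simp add: algebra_simps)
      then have "a = t - q * t" using True t(2) by (simp add: algebra_simps)
      then have "p * a = p * t - p * (q * t)" by (metis right_diff_distrib)
      then have "p * a = 0" using IH[OF t(1)] by simp
      then show ?thesis using True by simp
    qed (simp add: True)
  next
    case False
    then obtain r t where t: "t \<in> rspan M" "a = q * r + t"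
      using Cons.prems(2) by auto
    then show ?thesis using IH[OF t(1)] qq by (simp add: algebra_simps)
  qed
  from Cons.prems(3) obtain r t where t: "t \<in> rspan M" "s = a * r + t" by auto
  have "p * (q * (a * r)) = p * (a * r)" using a by (metis mult.assoc)
  then show ?case using t IH[OF t(1)] by (simp add: distrib_left)
qed simp

text \<open>A stage of the construction: the list spans the part \<open>e R\<close> of the ring reached so far.\<close>

definition stage :: "'a::ring \<times> 'a list \<Rightarrow> bool" where
  "stage = (\<lambda>(e, L). e * e = e \<and> rspan L = right_multiples e)"

text \<open>The condition \<open>p e = p\<close> extends \<open>p\<close> by \<open>0\<close> beyond the span of the list: it makes \<open>p\<close> vanish on
  every element killed by \<open>e\<close>.\<close>

definition compatible :: "'a::ring \<Rightarrow> 'a \<times> 'a list \<Rightarrow> bool" where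
  "compatible p = (\<lambda>(e, L). p * e = p \<and> adapted p L)"

text \<open>Since \<open>p e = p\<close> and \<open>q e = q\<close>, it suffices to compare \<open>p q\<close> with \<open>p\<close> at the element \<open>e\<close> of the
  span.\<close>

lemma adapted_mono:
  fixes p q :: "'a::ring"
  assumes "stage S" "compatible p S" "compatible q S" "q * q = q" "q * p = p"
  shows "p \<unlhd> q"
proof -
  obtain e L where S: "S = (e, L)" by force
  have e: "e * e = e" "e \<in> rspan L"
    using assms(1) mem_right_multiples_idem[of e e] by (auto simp: S stage_def)
  have "p * (q * e) = p * e"
    using assms e(2) by (intro adapted_eq_on_rspan) (auto simp: S compatible_def)
  then have "p * q = p" using assms(2,3) by (simp add: S compatible_def)
  then show ?thesis using assms(5) by (simp add: idem_le_def)
qed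

section \<open>Refining a list so that it decides an ideal\<close>

text \<open>Cutting an entry keeps every adapted idempotent adapted, because both pieces are right
  multiples of the entry: formally, \<open>h = a t\<close> and \<open>a - h = a (1 - t)\<close>.\<close>

lemma refines_cut:
  fixes a :: "'a::ring"
  assumes "refines M' M" "h = a * t"
  shows "refines (h # (a - h) # M') (a # M)"
  unfolding refines_def
proof (intro conjI allI impI)
  have M: "rspan M' = rspan M" using assms(1) by (simp add: refines_def)
  show "rspan (h # (a - h) # M') = rspan (a # M)"
  proof (intro equalityI subsetI)
    fix v assume "v \<in> rspan (h # (a - h) # M')"
    then obtain r1 r2 s where s: "s \<in> rspan M" "v = h * r1 + ((a - h) * r2 + s)"
      using M by auto
    have "v = a * (t * r1 + r2 - t * r2) + s"
      unfolding s(2) assms(2) by (simp add: algebra_simps)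
    with s(1) show "v \<in> rspan (a # M)" by auto
  next
    fix v assume "v \<in> rspan (a # M)"
    then obtain r s where s: "s \<in> rspan M'" "v = a * r + s" using M by auto
    have "v = h * r + ((a - h) * r + s)" using s(2) by (simp add: algebra_simps)
    with s(1) show "v \<in> rspan (h # (a - h) # M')" by auto
  qed
next
  fix q assume q: "adapted q (a # M)"
  then have qM: "adapted q M'" using assms(1) by (simp add: refines_def)
  show "adapted q (h # (a - h) # M')"
  proof (cases "q * a = 0")
    case True
    then have "q * h = 0" by (simp add: assms(2) mult.assoc[symmetric])
    then show ?thesis using True qM by (simp add: right_diff_distrib)
  next
    case False
    then obtain r s where s: "s \<in> rspan M'" "a = q * r + s"
      using q assms(1) by (auto simp: refines_def)
    have h: "h = q * (r * t) + s * t" unfolding assms(2) s(2)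
      by (simp add: algebra_simps)
    have "a - h = q * (r - r * t) + (s - s * t)"
      using h s(2) by (simp add: algebra_simps)
    moreover have "s - s * t \<in> rspan M'" by (intro rspan_diff rspan_mult s(1))
    moreover have "s * t \<in> rspan ((a - h) # M')"
      by (intro rspan_mono_Cons rspan_mult s(1))
    ultimately show ?thesis using qM h unfolding adapted.simps by blast
  qed
qed

text \<open>The induction on the list maintains an idempotent \<open>w\<close> whose image is the sum of the ideal
  and the span of the list. For \<open>d = a - w a\<close>, the ideal \<open>d R\<close> is isomorphic to
  \<open>(a R + w R) / w R\<close>, the part of \<open>a R\<close> that is new modulo this sum; with a reflexive inverse
  \<open>y\<close> of \<open>d\<close>, the piece \<open>h = a y d\<close> of \<open>a\<close> represents that part, whereas \<open>w\<close> fixes \<open>a - h\<close>.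
  The formal product \<open>g = a y (1 - w)\<close> projects onto \<open>h R\<close> along a complement containing \<open>w R\<close>; thus subtracting \<open>p g\<close> from \<open>p\<close> makes \<open>p\<close>
  vanish on \<open>h\<close> without changing anything on \<open>w R\<close>.\<close>

lemma exists_adapted_refinement_aux:
  fixes u :: "'a::ring"
  assumes reg: "von_neumann_regular TYPE('a)" and u: "u * u = u"
  shows "\<exists>L' p w. refines L' L \<and> p * p = p \<and> p * u = u \<and> u * p = p \<and> adapted p L' \<and>
           w * w = w \<and> w * p = p \<and> (\<forall>s\<in>rspan L'. w * s = s) \<and>
           (\<forall>c. \<exists>r. \<exists>s\<in>rspan L'. w * c = p * r + s)"
proof (induction L)
  case Nil
  show ?case
    using u by (intro exI[of _ "[]"] exI[of _ u]) (auto simp: refines_def)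
next
  case (Cons a M)
  then obtain M' p w where IH: "refines M' M" "p * p = p" "p * u = u" "u * p = p" "adapted p M'"
      "w * w = w" "w * p = p" "\<forall>s\<in>rspan M'. w * s = s"
    and img: "\<forall>c. \<exists>r. \<exists>s\<in>rspan M'. w * c = p * r + s"
    by blast
  define d where "d = a - w * a"
  obtain y where y: "d * y * d = d" "y * d * y = y"
    using regular_reflexive_inverse[OF reg] .
  define h where "h = a * (y * d)"
  define g where "g = a * y - a * y * w"
  define p' where "p' = p - p * g"
  define w' where "w' = w + g - w * g"
  have ww: "w * (w * c) = w * c" and wp: "w * (p * c) = p * c" for c
    using IH(6,7) by (metis mult.assoc)+
  have gw: "g * w = 0"
    using IH(6) by (simp add: g_def left_diff_distrib mult.assoc)
  have gw0: "g * c = 0" if "w * c = c" for c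
    using gw that by (metis mult.assoc mult_zero_left)
  have w_h: "w * (a - h) = a - h"
  proof -
    have "(a - h) - w * (a - h) = d - d * y * d"
      by (simp add: h_def d_def algebra_simps)
    then show ?thesis using y(1) by simp
  qed
  have g_a: "g * a = h"
    by (simp add: g_def h_def d_def algebra_simps)
  have g_h: "g * h = h"
  proof -
    have "g * h = g * a - g * (a - h)" by (simp add: algebra_simps)
    then show ?thesis using gw0[OF w_h] g_a by simp
  qed
  have h_y: "h * y = a * y" using y(2) by (simp add: h_def mult.assoc)
  have gg: "g * g = g"
  proof -
    have "g * g = h * y - h * y * w"
      using g_a by (simp add: g_def right_diff_distrib mult.assoc[symmetric])
    then show ?thesis using h_y by (simp add: g_def)
  qed
  have gp: "g * p = 0" using gw0 IH(7) by metis
  have p'p': "p' * p = p"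
    using gp IH(2) by (simp add: p'_def left_diff_distrib mult.assoc)
  have p'p: "p' * (p * c) = p * c" for c
    using p'p' by (metis mult.assoc)
  have p'w: "p' * c = p * c" if "w * c = c" for c
    using gw0[OF that] by (simp add: p'_def left_diff_distrib mult.assoc)
  have p'h: "p' * h = 0"
    using g_h by (simp add: p'_def left_diff_distrib mult.assoc)
  have w'w: "w' * c = c" if "w * c = c" for c
    using gw0[OF that] that by (simp add: w'_def algebra_simps)
  have w'h: "w' * h = h"
    using g_h by (simp add: w'_def algebra_simps)
  have w'g: "w' * g = g"
    using gg by (simp add: w'_def algebra_simps)
  let ?L = "h # (a - h) # M'"
  obtain r s where rs: "s \<in> rspan M'" "a - h = p' * r + s"
  proof -
    obtain r s where "s \<in> rspan M'" "a - h = p * r + s" using img w_h by metis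
    then show thesis using that[of s "p * r"] p'p by simp
  qed
  show ?case
  proof (intro exI conjI)
    show "refines ?L (a # M)"
      using refines_cut[OF IH(1), of h a "y * d"] by (simp add: h_def)
    show "p' * p' = p'"
      using p'p IH(2) by (simp add: p'_def right_diff_distrib) (metis p'_def p'p)
    show "p' * u = u" using p'w[of u] wp IH(3) by metis
    show "u * p' = p'"
      using IH(4) by (simp add: p'_def right_diff_distrib mult.assoc[symmetric])
    show "adapted p' ?L"
      using adapted_cong[OF reg IH(5), of p'] p'w IH(8) p'p' p'h rs by auto
    show "w' * w' = w'"
      using w'w[OF IH(6)] w'g w'w ww by (simp add: w'_def algebra_simps)
    show "w' * p' = p'"
      using w'w wp IH(7) by (simp add: p'_def right_diff_distrib mult.assoc[symmetric])
    show "\<forall>s\<in>rspan ?L. w' * s = s"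
    proof
      fix s assume "s \<in> rspan ?L"
      then obtain r1 r2 t where t: "t \<in> rspan M'" "s = h * r1 + ((a - h) * r2 + t)" by auto
      have "w' * (h * r1) = h * r1" "w' * ((a - h) * r2) = (a - h) * r2" "w' * t = t"
        using w'h w'w w_h IH(8) t(1) by (metis mult.assoc)+
      then show "w' * s = s" by (simp add: t(2) distrib_left)
    qed
    show "\<forall>c. \<exists>r. \<exists>s\<in>rspan ?L. w' * c = p' * r + s"
    proof
      fix c
      obtain r s where rs: "s \<in> rspan M'" "w * (c - g * c) = p * r + s" using img by blast
      have "g * c = h * (y * c - y * (w * c))"
        using h_y by (simp add: g_def algebra_simps) (metis mult.assoc)
      then have "w' * c = p' * (p * r) + (h * (y * c - y * (w * c)) + ((a - h) * 0 + s))"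
        using rs(2) p'p by (simp add: w'_def algebra_simps)
      moreover have "h * (y * c - y * (w * c)) + ((a - h) * 0 + s) \<in> rspan ?L"
        using rs(1) unfolding rspan.simps by blast
      ultimately show "\<exists>r. \<exists>s\<in>rspan ?L. w' * c = p' * r + s" by blast
    qed
  qed
qed

lemma exists_adapted_refinement:
  fixes u :: "'a::ring"
  assumes "von_neumann_regular TYPE('a)" "u * u = u"
  obtains L' p where "refines L' L" "p * p = p" "p * u = u" "u * p = p" "adapted p L'"
  using exists_adapted_refinement_aux[OF assms, of L] by blast

section \<open>The sequence of stages\<close>

text \<open>Two moves: appending \<open>d = x - e x\<close> makes the list span \<open>x R\<close> as well, and refining the
  longer list makes it decide \<open>x R\<close>. Compatible idempotents vanish on \<open>d\<close> because \<open>e d = 0\<close>.\<close>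

lemma next_stage:
  fixes x :: "'a::ring"
  assumes reg: "von_neumann_regular TYPE('a)" and S: "stage S"
  shows "\<exists>S'. stage S' \<and> (\<forall>q. compatible q S \<longrightarrow> compatible q S') \<and>
           (\<exists>p. p * p = p \<and> right_multiples p = right_multiples x \<and> compatible p S')"
proof -
  obtain e L where SL: "S = (e, L)" by force
  have e: "e * e = e" and L: "rspan L = right_multiples e"
    using S by (auto simp: SL stage_def)
  have ee: "e * (e * c) = e * c" for c using e by (metis mult.assoc)
  define d where "d = x - e * x"
  obtain y where y: "d * y * d = d" using regular_reflexive_inverse[OF reg] .
  \<comment> \<open>The image of \<open>v\<close> is \<open>d R\<close>, and \<open>e v = 0\<close>; so \<open>e' = e + v (1 - e)\<close> projects onto \<open>e R + d R\<close>.\<close>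
  define v where "v = d * y"
  define e' where "e' = e + v - v * e"
  have ed: "e * d = 0" using ee by (simp add: d_def right_diff_distrib)
  then have ev: "e * v = 0" by (simp add: v_def mult.assoc[symmetric])
  have vd: "v * d = d" using y by (simp add: v_def)
  have e'e: "e' * e = e" using e by (simp add: e'_def algebra_simps)
  have e'd: "e' * d = d" using ed vd by (simp add: e'_def algebra_simps)
  have e'v: "e' * v = v" using e'd by (simp add: v_def mult.assoc[symmetric])
  have e'e': "e' * e' = e'"
  proof -
    have "e' * e' = e' * e + e' * v - e' * v * e"
      by (subst (2) e'_def) (simp add: algebra_simps)
    then show ?thesis using e'e e'v by (simp add: e'_def)
  qed
  have e_e': "e * e' = e" using e ev by (simp add: e'_def algebra_simps mult.assoc[symmetric])
  have e'x: "e' * x = x"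
  proof -
    have "e' * x = e' * e * x + e' * d" by (simp add: d_def algebra_simps)
    then show ?thesis unfolding e'e e'd by (simp add: d_def)
  qed
  have L': "rspan (d # L) = right_multiples e'"
  proof (intro equalityI subsetI)
    fix s assume "s \<in> rspan (d # L)"
    then obtain r t where t: "e * t = t" "s = d * r + t"
      using L mem_right_multiples_idem[OF e] by auto
    have "e' * (d * r) = d * r" "e' * t = t" using e'd e'e t(1) by (metis mult.assoc)+
    then show "s \<in> right_multiples e'"
      using mem_right_multiples_idem[OF e'e'] by (simp add: t(2) distrib_left)
  next
    fix s assume "s \<in> right_multiples e'"
    then have "s = e' * s" using mem_right_multiples_idem[OF e'e'] by simp
    also have "\<dots> = d * (y * s - y * (e * s)) + e * s"
      by (simp add: e'_def v_def algebra_simps)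
    finally show "s \<in> rspan (d # L)" using L by (auto simp: right_multiples_def)
  qed
  obtain z where z: "x * z * x = x" using regular_reflexive_inverse[OF reg] .
  define u where "u = x * z"
  have ux: "u * x = x" and uu: "u * u = u" using z by (simp_all add: u_def mult.assoc[symmetric])
  have uR: "right_multiples u = right_multiples x"
    unfolding right_multiples_def using ux by (auto simp: u_def mult.assoc) (metis rangeI mult.assoc)
  obtain L' p where p: "refines L' (d # L)" "p * p = p" "p * u = u" "u * p = p" "adapted p L'"
    using exists_adapted_refinement[OF reg uu] .
  have e'p: "e' * p = p" using e'x p(4) by (metis u_def mult.assoc)
  \<comment> \<open>Multiplication by \<open>e'\<close> makes \<open>p\<close> vanish on all entries that later stages append.\<close>
  define p' where "p' = p * e'"
  have p'_eq: "p' * s = p * s" if "s \<in> rspan L'" for s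
    using that p(1) L' mem_right_multiples_idem[OF e'e'] by (simp add: p'_def mult.assoc refines_def)
  have p'p: "p' * p = p" using e'p p(2) by (simp add: p'_def mult.assoc)
  have p'p': "p' * p' = p'" using p'p by (metis p'_def mult.assoc)
  have "p' * u = u" using p'p p(4,3) by (metis mult.assoc)
  moreover have "u * p' = p'" using p(4) by (simp add: p'_def mult.assoc[symmetric])
  ultimately have "right_multiples p' = right_multiples x"
    using right_multiples_idem_subset uu p'p' uR by blast
  moreover have "adapted p' L'" using adapted_cong[OF reg p(5) p'_eq p'p] .
  moreover have "p' * e' = p'" using e'e' by (simp add: p'_def mult.assoc)
  moreover have "stage (e', L')" using e'e' L' p(1) by (simp add: stage_def refines_def)
  moreover have "compatible q (e', L')" if "compatible q S" for q
  proof -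
    have q: "q * e = q" "adapted q L" using that by (simp_all add: SL compatible_def)
    have "q * d = 0" using q(1) ed by (metis mult.assoc mult_zero_right)
    then have "adapted q L'" using q(2) p(1) by (simp add: refines_def)
    moreover have "q * e' = q" using q(1) e_e' by (metis mult.assoc)
    ultimately show ?thesis by (simp add: compatible_def)
  qed
  ultimately show ?thesis using p'p' by (auto simp: compatible_def)
qed

theorem corollary4p6:
  assumes "countable (UNIV :: 'a::ring set)"
    and "von_neumann_regular TYPE('a)"
  shows "\<exists>f :: 'a \<Rightarrow> 'a. banaschewski_function f"
proof -
  let ?x = "from_nat_into (UNIV :: 'a set)"
  let ?solves = "\<lambda>p x (S :: 'a \<times> 'a list).
    p * p = p \<and> right_multiples p = right_multiples x \<and> compatible p S"
  have "stage (0 :: 'a, [])" by (auto simp: stage_def right_multiples_def)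
  then have "\<exists>S. \<forall>n. stage (S n) \<and> ((\<forall>q. compatible q (S n) \<longrightarrow> compatible q (S (Suc n))) \<and>
      (\<exists>p. ?solves p (?x n) (S (Suc n))))"
    using next_stage[OF assms(2)] by (intro dependent_nat_choice) blast+
  then obtain S where stage: "\<And>n. stage (S n)"
    and step: "\<And>n q. compatible q (S n) \<Longrightarrow> compatible q (S (Suc n))"
    and solved: "\<And>n. \<exists>p. ?solves p (?x n) (S (Suc n))"
    by blast
  have mono: "compatible q (S n)" if "compatible q (S m)" "m \<le> n" for q m n
    using that(2,1) by (induction rule: dec_induct) (auto intro: step)
  have "\<exists>p n. ?solves p x (S n)" for x
    using solved[of "to_nat_on UNIV x"] assms(1) by auto
  then obtain f N where f: "\<And>x. ?solves (f x) x (S (N x))" by metis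
  have "f x \<unlhd> f y" if "right_multiples x \<subseteq> right_multiples y" for x y
  proof (rule adapted_mono)
    show "stage (S (max (N x) (N y)))" by (rule stage)
    show "compatible (f x) (S (max (N x) (N y)))" "compatible (f y) (S (max (N x) (N y)))"
      using f mono by (meson max.cobounded1 max.cobounded2)+
    show "f y * f y = f y" using f by blast
    show "f y * f x = f x" using f that right_multiples_idem_subset by metis
  qed
  then have "banaschewski_function f"
    using f unfolding banaschewski_function_def idempotents_def by auto
  then show ?thesis by blast
qed

end
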